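(* Let $n\ge3$, $\beta>0$, $\gamma>1$ with $\beta\gamma<n$, $p,q>0$ with $pq>(\gamma-1)^2$, $\sigma_1,\sigma_2\in(-\beta\gamma,\infty)$, and $c_1,c_2$ double bounded. Let $(u,v)$ be a bounded positive solution of the system $u(x)=c_1(x)W_{\beta,\gamma}(|y|^{\sigma_1}v^q)(x)$, $v(x)=c_2(x)W_{\beta,\gamma}(|y|^{\sigma_2}u^p)(x)$ ($x\in\mathbb{R}^n$). Then: (i) If $\theta_1<q_0$ and $\theta_2<p_0$, there is no constant $c>0$ such that either $u(x)\ge c(1+|x|)^{-\theta_1}$ for a.e. $x\in\mathbb{R}^n$ or $v(x)\ge c(1+|x|)^{-\theta_2}$ for a.e. $x\in\mathbb{R}^n$. (ii) If $\theta_3>q_0$, $\theta_4>p_0$ and $(u,v)$ is not integrable (i.e. $u\notin L^{r_0}(\mathbb{R}^n)$ or $v\notin L^{s_0}(\mathbb{R}^n)$), there is no constant $C>0$ such that either $u(x)\le C(1+|x|)^{-\theta_3}$ for a.e. $x$ or $v(x)\le C(1+|x|)^{-\theta_4}$ for a.e. $x$. (iii) If $(u,v)$ is a decaying solution which is not integrable, then $u(x)\simeq|x|^{-q_0}$ and $v(x)\simeq|x|^{-p_0}$.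
   Context: For $f\ge 0$, $f\in L^1_{loc}(\mathbb{R}^n)$, the Wolff potential is $W_{\beta,\gamma}(f)(x)=\int_0^\infty\Big(\frac{\int_{B_t(x)}f(y)\,dy}{t^{n-\beta\gamma}}\Big)^{\frac{1}{\gamma-1}}\frac{dt}{t}$, where $B_t(x)$ is the open ball of radius $t$ centered at $x$. A function $c:\mathbb{R}^n\to\mathbb{R}$ is double bounded if there is $C>0$ with $1/C\le c(x)\le C$ for all $x$. A solution is a pair of nonnegative $u,v\in L^1_{loc}(\mathbb{R}^n)$ satisfying both equations a.e.; positive if $u,v>0$. For a positive function $f$ and $\theta>0$, $f(x)\simeq|x|^{-\theta}$ means there is $c>0$ with $1/c\le|x|^\theta f(x)\le c$ for all sufficiently large $|x|$. A positive solution is decaying if there exist $\theta_1,\theta_2>0$ with $u(x)\simeq|x|^{-\theta_1}$, $v(x)\simeq|x|^{-\theta_2}$. Here $q_0=\frac{\beta\gamma(\gamma-1+q)+(\gamma-1)\sigma_1+\sigma_2 q}{pq-(\gamma-1)^2}$, $p_0=\frac{\beta\gamma(\gamma-1+p)+(\gamma-1)\sigma_2+\sigma_1 p}{pq-(\gamma-1)^2}$, $r_0=n/q_0$, $s_0=n/p_0$; $(u,v)$ is integrable if $(u,v)\in L^{r_0}(\mathbb{R}^n)\times L^{s_0}(\mathbb{R}^n)$. *)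

theory Defs
  imports "HOL-Analysis.Analysis"
begin

text \<open>Real power of an extended nonnegative real (exponent assumed positive):
  infinity stays infinity.\<close>
definition enn_powr :: "ennreal \<Rightarrow> real \<Rightarrow> ennreal" where
  "enn_powr a e = (if a = \<infinity> then \<infinity> else ennreal (enn2real a powr e))"

definition wolff :: "real \<Rightarrow> real \<Rightarrow> (real^'n \<Rightarrow> real) \<Rightarrow> real^'n \<Rightarrow> ennreal" where
  "wolff \<beta> \<gamma> f x =
     (\<integral>\<^sup>+ t \<in> {0<..}.
        enn_powr ((\<integral>\<^sup>+ y \<in> ball x t. ennreal (f y) \<partial>lebesgue)
                    / ennreal (t powr (real CARD('n) - \<beta> * \<gamma>)))
                 (1 / (\<gamma> - 1))
        / ennreal t \<partial>lborel)"

definition double_bounded :: "('a \<Rightarrow> real) \<Rightarrow> bool" where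
  "double_bounded c \<longleftrightarrow> (\<exists>C>0. \<forall>x. 1 / C \<le> c x \<and> c x \<le> C)"

definition locally_integrable :: "(real^'n \<Rightarrow> real) \<Rightarrow> bool" where
  "locally_integrable f \<longleftrightarrow> (\<forall>K. compact K \<longrightarrow> set_integrable lebesgue K f)"

text \<open>L^r(R^n) for r > 0 (r may be < 1).\<close>
definition in_Lp :: "real \<Rightarrow> (real^'n \<Rightarrow> real) \<Rightarrow> bool" where
  "in_Lp r f \<longleftrightarrow> f \<in> borel_measurable lebesgue \<and>
     (\<integral>\<^sup>+ x. ennreal (\<bar>f x\<bar> powr r) \<partial>lebesgue) < \<infinity>"

definition wolff_solution ::
  "real \<Rightarrow> real \<Rightarrow> real \<Rightarrow> real \<Rightarrow> real \<Rightarrow> real \<Rightarrow> (real^'n \<Rightarrow> real) \<Rightarrow> (real^'n \<Rightarrow> real)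
   \<Rightarrow> (real^'n \<Rightarrow> real) \<Rightarrow> (real^'n \<Rightarrow> real) \<Rightarrow> bool" where
  "wolff_solution \<beta> \<gamma> p q \<sigma>\<^sub>1 \<sigma>\<^sub>2 c\<^sub>1 c\<^sub>2 u v \<longleftrightarrow>
     (\<forall>x. u x \<ge> 0) \<and> (\<forall>x. v x \<ge> 0) \<and> locally_integrable u \<and> locally_integrable v \<and>
     (AE x in lebesgue. ennreal (u x) =
        ennreal (c\<^sub>1 x) * wolff \<beta> \<gamma> (\<lambda>y. norm y powr \<sigma>\<^sub>1 * v y powr q) x) \<and>
     (AE x in lebesgue. ennreal (v x) =
        ennreal (c\<^sub>2 x) * wolff \<beta> \<gamma> (\<lambda>y. norm y powr \<sigma>\<^sub>2 * u y powr p) x)"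

definition sim_pow :: "(real^'n \<Rightarrow> real) \<Rightarrow> real \<Rightarrow> bool" where
  "sim_pow f \<theta> \<longleftrightarrow> (\<exists>c>0. \<exists>R. \<forall>x. norm x \<ge> R \<longrightarrow>
      1 / c \<le> norm x powr \<theta> * f x \<and> norm x powr \<theta> * f x \<le> c)"

definition decaying :: "(real^'n \<Rightarrow> real) \<Rightarrow> (real^'n \<Rightarrow> real) \<Rightarrow> bool" where
  "decaying u v \<longleftrightarrow> (\<forall>x. u x > 0) \<and> (\<forall>x. v x > 0) \<and>
     (\<exists>\<theta>\<^sub>1>0. \<exists>\<theta>\<^sub>2>0. sim_pow u \<theta>\<^sub>1 \<and> sim_pow v \<theta>\<^sub>2)"

definition q0 :: "real \<Rightarrow> real \<Rightarrow> real \<Rightarrow> real \<Rightarrow> real \<Rightarrow> real \<Rightarrow> real" where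
  "q0 \<beta> \<gamma> p q \<sigma>\<^sub>1 \<sigma>\<^sub>2 = (\<beta>*\<gamma>*(\<gamma>-1+q) + (\<gamma>-1)*\<sigma>\<^sub>1 + \<sigma>\<^sub>2*q) / (p*q - (\<gamma>-1)^2)"

definition p0 :: "real \<Rightarrow> real \<Rightarrow> real \<Rightarrow> real \<Rightarrow> real \<Rightarrow> real \<Rightarrow> real" where
  "p0 \<beta> \<gamma> p q \<sigma>\<^sub>1 \<sigma>\<^sub>2 = (\<beta>*\<gamma>*(\<gamma>-1+p) + (\<gamma>-1)*\<sigma>\<^sub>2 + \<sigma>\<^sub>1*p) / (p*q - (\<gamma>-1)^2)"

definition integrable_pair ::
  "real \<Rightarrow> real \<Rightarrow> real \<Rightarrow> real \<Rightarrow> real \<Rightarrow> real \<Rightarrow> (real^'n \<Rightarrow> real) \<Rightarrow> (real^'n \<Rightarrow> real) \<Rightarrow> bool" where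
  "integrable_pair \<beta> \<gamma> p q \<sigma>\<^sub>1 \<sigma>\<^sub>2 u v \<longleftrightarrow>
     in_Lp (real CARD('n) / q0 \<beta> \<gamma> p q \<sigma>\<^sub>1 \<sigma>\<^sub>2) u \<and>
     in_Lp (real CARD('n) / p0 \<beta> \<gamma> p q \<sigma>\<^sub>1 \<sigma>\<^sub>2) v"

end

theory Submission
  imports Defs
begin

text \<open>
  Write \<alpha> = \<beta>\<gamma>, k = \<gamma> - 1, Q = \<open>q0\<close>, P = \<open>p0\<close>; these exponents are the solution of
  k Q = q P - \<alpha> - \<open>\<sigma>\<^sub>1\<close> and k P = p Q - \<alpha> - \<open>\<sigma>\<^sub>2\<close>.
  A lower bound \<open>(1 + |y|)\<close> to the power \<open>-\<theta>\<close> for v yields, through the Wolff potential, one for u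
  with exponent (q\<theta> - \<alpha> - \<open>\<sigma>\<^sub>1\<close>)/k, and symmetrically. A round trip multiplies Q - \<theta> by
  pq/k^2 > 1, so a start with \<theta> < Q leads to a lower bound with negative exponent, against boundedness.
  Upper bounds transform in the same way as long as the density decays at a rate strictly between
  \<alpha> and n.

  If u decays with an exponent just above Q and P < (n - \<alpha>)/k, one such step makes v decay faster
  than P, so both functions are integrable. If P \<ge> (n - \<alpha>)/k, the universal lower bound with
  exponent (n - \<alpha>)/k for v gives a lower bound with exponent Q for u,
  which excludes faster decay. Decay rates of decaying solutions are squeezed between the two.
\<close>

subsection \<open>Integrals of radial powers\<close>

lemma emeasure_lebesgue_ball:
  assumes "r \<ge> 0"
  shows "emeasure lebesgue (ball (x::'a::euclidean_space) r)
    = ennreal (unit_ball_vol (real DIM('a)) * r powr real DIM('a))"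
proof -
  have "r ^ DIM('a) = r powr real DIM('a)"
    using assms by (cases "r = 0") (auto simp: powr_realpow)
  then show ?thesis
    using emeasure_ball[OF assms, of x] by simp
qed

lemma borel_measurable_lebesgue_ball:
  fixes f :: "'a::euclidean_space \<Rightarrow> ennreal"
  assumes [measurable]: "f \<in> borel_measurable borel"
  shows "(\<lambda>y. f y * indicator (ball x t) y) \<in> borel_measurable lebesgue"
proof -
  define A where "A = ball x t"
  have [measurable]: "A \<in> sets borel"
    by (simp add: A_def)
  have "(\<lambda>y. f y * indicator A y) \<in> borel_measurable lborel"
    by measurable
  then show ?thesis
    unfolding A_def by (rule measurable_completion)
qed

lemma nn_integral_powr_0:
  assumes "e > 0" "R > 0"
  shows "(\<integral>\<^sup>+ t. ennreal (t powr (e - 1)) * indicator {0..R} t \<partial>lborel) = ennreal (R powr e / e)"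
proof -
  have "((\<lambda>t. t powr (e - 1)) has_integral (R powr e / e)) {0..R}"
    using has_integral_powr_from_0[of "e - 1" R] assms by simp
  then show ?thesis
    by (intro nn_integral_has_integral_lebesgue') auto
qed

lemma nn_integral_powr_inf:
  assumes "e > 0" "R > 0"
  shows "(\<integral>\<^sup>+ t. ennreal (t powr (- e - 1)) * indicator {R..} t \<partial>lborel) = ennreal (R powr (- e) / e)"
proof -
  have "((\<lambda>t. t powr (- e - 1)) has_integral (R powr (- e) / e)) {R..}"
    using has_integral_powr_to_inf[of "- e - 1" R] assms by simp
  then show ?thesis
    by (intro nn_integral_has_integral_lebesgue') auto
qed

lemma ennreal_le_suminf: "f j \<le> (\<Sum>i. f i)" for f :: "nat \<Rightarrow> ennreal"
  using sum_le_suminf[of f "{j}"] by simp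

text \<open>At almost every point where \<open>h\<close> is positive, one term of the series of
  \<open>c j\<close> times ball indicators dominates it, hence so does the whole series, which is
  integrated termwise. In the dyadic applications below, overlapping balls instead of disjoint
  shells cost only a constant.\<close>

lemma nn_integral_le_sums_balls:
  fixes h :: "'a::euclidean_space \<Rightarrow> real" and c r :: "nat \<Rightarrow> real"
  assumes "AE y in lebesgue. h y \<le> 0 \<or> (\<exists>j. norm y < r j \<and> h y \<le> c j)"
    and c: "\<And>j. c j \<ge> 0" and r: "\<And>j. r j \<ge> 0"
    and S: "(\<lambda>j. c j * r j powr real DIM('a)) sums S"
  shows "(\<integral>\<^sup>+ y. ennreal (h y) \<partial>lebesgue) \<le> ennreal (unit_ball_vol (real DIM('a)) * S)"
proof -
  let ?g = "\<lambda>j y. ennreal (c j) * indicator (ball (0::'a) (r j)) y"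
  let ?V = "unit_ball_vol (real DIM('a))"
  have [measurable]: "ball (0::'a) (r j) \<in> sets lebesgue" for j
    by simp
  have "(\<integral>\<^sup>+ y. ennreal (h y) \<partial>lebesgue) \<le> (\<integral>\<^sup>+ y. (\<Sum>j. ?g j y) \<partial>lebesgue)"
    using assms(1)
  proof (intro nn_integral_mono_AE, elim eventually_mono disjE exE conjE)
    fix y j assume j: "norm y < r j" "h y \<le> c j"
    then have "ennreal (h y) \<le> ?g j y"
      by (auto intro: ennreal_leI)
    also have "\<dots> \<le> (\<Sum>j. ?g j y)"
      by (rule ennreal_le_suminf)
    finally show "ennreal (h y) \<le> (\<Sum>j. ?g j y)" .
  qed (simp add: ennreal_neg)
  also have "\<dots> = (\<Sum>j. \<integral>\<^sup>+ y. ?g j y \<partial>lebesgue)"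
    by (rule nn_integral_suminf) measurable
  also have "\<dots> = (\<Sum>j. ennreal (?V * (c j * r j powr real DIM('a))))"
  proof (intro arg_cong[of _ _ suminf] ext)
    fix j
    have "(\<integral>\<^sup>+ y. ?g j y \<partial>lebesgue) = ennreal (c j) * ennreal (?V * r j powr real DIM('a))"
      using r[of j] by (subst nn_integral_cmult_indicator) (simp_all only: emeasure_lebesgue_ball, simp)
    then show "(\<integral>\<^sup>+ y. ?g j y \<partial>lebesgue) = ennreal (?V * (c j * r j powr real DIM('a)))"
      using c[of j] by (simp add: ennreal_mult[symmetric] mult_ac)
  qed
  also have "\<dots> = ennreal (?V * S)"
    using c sums_mult[OF S, of ?V] by (intro suminf_ennreal_eq) auto
  finally show ?thesis .
qed

text \<open>Dyadic shells of outer radius \<open>r j = t * 2 powr (- real j)\<close> shrink to the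
  origin. The maximum \<open>c j\<close> on a shell times the volume of its outer ball is geometric
  with ratio \<open>z\<close>, and \<open>z < 1\<close> because \<open>b\<close> is below the
  dimension.\<close>

lemma nn_integral_norm_powr_ball_0:
  assumes b: "0 \<le> b" "b < real DIM('a)"
  shows "\<exists>C>0. \<forall>t>0. (\<integral>\<^sup>+ y\<in>ball (0::'a::euclidean_space) t. ennreal (norm y powr (- b)) \<partial>lebesgue)
     \<le> ennreal (C * t powr (real DIM('a) - b))"
proof -
  let ?d = "real DIM('a)" and ?V = "unit_ball_vol (real DIM('a))"
  define z where "z = 2 powr (b - ?d)"
  have z: "0 < z" "z < 1"
    using b by (auto simp: z_def powr_less_one)
  define C where "C = ?V * (2 powr b * (1 / (1 - z)))"
  have "C > 0"
    using z by (auto simp: C_def)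
  moreover have "(\<integral>\<^sup>+ y\<in>ball (0::'a) t. ennreal (norm y powr (- b)) \<partial>lebesgue)
     \<le> ennreal (C * t powr (?d - b))" if t: "t > 0" for t
  proof -
    define r where "r j = t * 2 powr (- real j)" for j :: nat
    define c where "c j = (r j / 2) powr (- b)" for j
    have rpos: "r j > 0" for j
      using t by (simp add: r_def)
    have term_eq: "c j * r j powr ?d = 2 powr b * t powr (?d - b) * z ^ j" for j
    proof -
      have "c j * r j powr ?d = 2 powr b * r j powr (?d - b)"
        using rpos[of j] by (simp add: c_def powr_divide powr_minus powr_diff field_simps)
      also have "r j powr (?d - b) = t powr (?d - b) * (2 powr (- real j)) powr (?d - b)"
        using t by (simp add: r_def powr_mult)
      also have "(2 powr (- real j)) powr (?d - b) = z ^ j"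
        using z by (simp add: z_def powr_powr powr_realpow[symmetric] algebra_simps)
      finally show ?thesis by simp
    qed
    have "(\<lambda>j. z ^ j) sums (1 / (1 - z))"
      using z by (intro geometric_sums) auto
    then have S: "(\<lambda>j. c j * r j powr ?d) sums (2 powr b * t powr (?d - b) * (1 / (1 - z)))"
      unfolding term_eq by (rule sums_mult)
    have cover: "norm y powr (- b) * indicat_real (ball 0 t) y \<le> 0 \<or>
      (\<exists>j. norm y < r j \<and> norm y powr (- b) * indicat_real (ball 0 t) y \<le> c j)" if "y \<noteq> 0" for y :: 'a
    proof (cases "norm y < t")
      case True
      have y0: "norm y > 0" using that by simp
      define l where "l = log 2 (t / norm y)"
      have lpos: "l > 0"
        unfolding l_def using True y0 t by (subst zero_less_log_cancel_iff) auto
      \<comment> \<open>Rounding up and subtracting 1, rather than rounding down, gives the strict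
        \<open>j < l\<close> that the open ball of radius \<open>r j\<close> requires when
        \<open>l\<close> is an integer.\<close>
      define j where "j = nat (\<lceil>l\<rceil> - 1)"
      have j: "real j < l" "l \<le> real j + 1"
        using lpos unfolding j_def by linarith+
      have nl: "norm y = t * 2 powr (- l)"
        using t y0 by (simp add: l_def powr_minus)
      have "norm y < r j"
        using j t unfolding nl r_def by simp
      moreover have "r j / 2 \<le> norm y"
      proof -
        have "r j / 2 = t * 2 powr (- real j - 1)"
          by (simp add: r_def powr_diff)
        also have "\<dots> \<le> norm y"
          unfolding nl using j t by (intro mult_left_mono powr_mono) auto
        finally show ?thesis .
      qed
      then have "norm y powr (- b) \<le> c j"
        unfolding c_def using rpos[of j] b by (intro powr_mono2') auto
      moreover have "norm y powr (- b) * indicat_real (ball 0 t) y = norm y powr (- b)"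
        using True by simp
      ultimately show ?thesis by auto
    qed simp
    have "(\<integral>\<^sup>+ y\<in>ball (0::'a) t. ennreal (norm y powr (- b)) \<partial>lebesgue)
      = (\<integral>\<^sup>+ y. ennreal (norm y powr (- b) * indicat_real (ball (0::'a) t) y) \<partial>lebesgue)"
      by (intro nn_integral_cong) (auto simp: indicator_def)
    also have "\<dots> \<le> ennreal (?V * (2 powr b * t powr (?d - b) * (1 / (1 - z))))"
    proof (rule nn_integral_le_sums_balls[OF _ _ _ S])
      have "AE y in lebesgue. y \<noteq> (0::'a)"
        by (rule AE_I'[of "{0}"]) (auto simp flip: negligible_iff_null_sets)
      then show "AE y in lebesgue. norm y powr (- b) * indicat_real (ball (0::'a) t) y \<le> 0 \<or>
          (\<exists>j. norm y < r j \<and> norm y powr (- b) * indicat_real (ball 0 t) y \<le> c j)"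
        by eventually_elim (rule cover)
    qed (use rpos in \<open>auto simp: c_def intro: less_imp_le\<close>)
    also have "?V * (2 powr b * t powr (?d - b) * (1 / (1 - z))) = C * t powr (?d - b)"
      by (simp add: C_def)
    finally show ?thesis .
  qed
  ultimately show ?thesis by blast
qed

text \<open>Inside the ball around x, points of norm below t are covered by the ball around 0, and at the
  others the integrand is at most \<open>t\<close> to the power \<open>-b\<close>; this makes the bound uniform in x.\<close>
lemma nn_integral_norm_powr_ball:
  assumes b: "0 \<le> b" "b < real DIM('a)"
  shows "\<exists>C>0. \<forall>x. \<forall>t>0. (\<integral>\<^sup>+ y\<in>ball (x::'a::euclidean_space) t. ennreal (norm y powr (- b)) \<partial>lebesgue)
     \<le> ennreal (C * t powr (real DIM('a) - b))"
proof -
  let ?d = "real DIM('a)" and ?V = "unit_ball_vol (real DIM('a))"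
  obtain C0 where C0: "C0 > 0" and ball0: "\<And>t. t > 0 \<Longrightarrow>
      (\<integral>\<^sup>+ y\<in>ball (0::'a) t. ennreal (norm y powr (- b)) \<partial>lebesgue) \<le> ennreal (C0 * t powr (?d - b))"
    using nn_integral_norm_powr_ball_0[OF b] by blast
  have "(\<integral>\<^sup>+ y\<in>ball x t. ennreal (norm y powr (- b)) \<partial>lebesgue) \<le> ennreal ((C0 + ?V) * t powr (?d - b))"
    if t: "t > 0" for x :: 'a and t
  proof -
    have "(\<integral>\<^sup>+ y\<in>ball x t. ennreal (norm y powr (- b)) \<partial>lebesgue)
      \<le> (\<integral>\<^sup>+ y. ennreal (norm y powr (- b)) * indicator (ball (0::'a) t) y
          + ennreal (t powr (- b)) * indicator (ball x t) y \<partial>lebesgue)"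
    proof (intro nn_integral_mono)
      fix y :: 'a
      have "norm y powr (- b) \<le> t powr (- b)" if "\<not> norm y < t"
        using that t b by (intro powr_mono2') auto
      then show "ennreal (norm y powr (- b)) * indicator (ball x t) y
        \<le> ennreal (norm y powr (- b)) * indicator (ball 0 t) y + ennreal (t powr (- b)) * indicator (ball x t) y"
        by (auto simp: indicator_def intro: ennreal_leI)
    qed
    also have "\<dots> = (\<integral>\<^sup>+ y\<in>ball (0::'a) t. ennreal (norm y powr (- b)) \<partial>lebesgue)
        + ennreal (t powr (- b)) * emeasure lebesgue (ball x t)"
    proof -
      have m: "(\<lambda>y. ennreal (norm y powr (- b)) * indicator (ball (0::'a) t) y) \<in> borel_measurable lebesgue"
        "(\<lambda>y. ennreal (t powr (- b)) * indicator (ball x t) y) \<in> borel_measurable lebesgue"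
        by (intro borel_measurable_lebesgue_ball; measurable)+
      have "ball x t \<in> sets lebesgue"
        by simp
      from nn_integral_cmult_indicator[OF this, of "ennreal (t powr (- b))"] show ?thesis
        unfolding nn_integral_add[OF m] by (simp only:)
    qed
    also have "\<dots> \<le> ennreal (C0 * t powr (?d - b)) + ennreal (t powr (- b)) * ennreal (?V * t powr ?d)"
      using ball0[OF t] emeasure_lebesgue_ball[of t x] t by (intro add_mono mult_left_mono) auto
    also have "\<dots> = ennreal ((C0 + ?V) * t powr (?d - b))"
      using C0 by (simp add: ennreal_mult[symmetric] ennreal_plus[symmetric] powr_diff powr_minus divide_inverse
        algebra_simps del: ennreal_plus)
    finally show ?thesis .
  qed
  moreover have "C0 + ?V > 0"
    using C0 by (simp add: add_pos_nonneg)
  ultimately show ?thesis by blast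
qed

text \<open>Dyadic shells towards infinity: on \<open>2^j \<le> 1 + norm y < 2^(j+1)\<close> the
  integrand is at most \<open>c j\<close>, and the volumes grow slowly enough for a geometric series
  with ratio \<open>z < 1\<close>.\<close>

lemma nn_integral_one_plus_norm_powr_finite:
  assumes s: "s > real DIM('a)"
  shows "(\<integral>\<^sup>+ y. ennreal ((1 + norm (y::'a::euclidean_space)) powr (- s)) \<partial>lebesgue) < \<infinity>"
proof -
  let ?d = "real DIM('a)"
  define z where "z = 2 powr (?d - s)"
  have z: "0 < z" "z < 1"
    using s by (auto simp: z_def powr_less_one)
  define r where "r j = 2 * 2 powr (real j)" for j :: nat
  define c where "c j = (2 powr (real j)) powr (- s)" for j :: nat
  have term_eq: "c j * r j powr ?d = 2 powr ?d * z ^ j" for j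
    by (simp add: r_def c_def z_def powr_mult powr_powr powr_realpow[symmetric] powr_add[symmetric] algebra_simps)
  have "(\<lambda>j. z ^ j) sums (1 / (1 - z))"
    using z by (intro geometric_sums) auto
  then have S: "(\<lambda>j. c j * r j powr ?d) sums (2 powr ?d * (1 / (1 - z)))"
    unfolding term_eq by (rule sums_mult)
  have "\<exists>j. norm y < r j \<and> (1 + norm y) powr (- s) \<le> c j" for y :: 'a
  proof -
    define l where "l = log 2 (1 + norm y)"
    define j where "j = nat \<lfloor>l\<rfloor>"
    have "l \<ge> 0"
      unfolding l_def by (subst zero_le_log_cancel_iff) (auto intro: add_pos_nonneg)
    then have j: "real j \<le> l" "l < real j + 1"
      unfolding j_def by linarith+
    have nl: "1 + norm y = 2 powr l"
      unfolding l_def by (simp add: add_pos_nonneg)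
    have "1 + norm y < r j"
      using j powr_less_mono[of l "1 + real j" 2] unfolding nl r_def by (simp add: powr_add)
    moreover have "(1 + norm y) powr (- s) \<le> c j"
      unfolding c_def nl using j s by (intro powr_mono2') auto
    ultimately show ?thesis by (intro exI[of _ j]) simp
  qed
  then have "(\<integral>\<^sup>+ y. ennreal ((1 + norm (y::'a)) powr (- s)) \<partial>lebesgue)
      \<le> ennreal (unit_ball_vol ?d * (2 powr ?d * (1 / (1 - z))))"
    by (intro nn_integral_le_sums_balls[OF _ _ _ S]) (auto simp: c_def r_def)
  then show ?thesis
    by (rule le_less_trans) simp
qed

subsection \<open>Two-sided power bounds for Wolff potentials\<close>

lemma enn_powr_mono:
  assumes "a \<le> b" "0 \<le> e"
  shows "enn_powr a e \<le> enn_powr b e"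
proof (cases "b = \<infinity>")
  case False
  then have "a \<noteq> \<infinity>"
    using assms(1) by (auto simp: top_unique)
  then show ?thesis
    using False assms unfolding enn_powr_def
    by (auto intro!: ennreal_leI powr_mono2 enn2real_mono simp: less_top)
qed (simp add: enn_powr_def)

lemma enn_powr_ennreal: "0 \<le> r \<Longrightarrow> enn_powr (ennreal r) e = ennreal (r powr e)"
  by (simp add: enn_powr_def)

text \<open>A mass that is an exact power of the radius gives an integrand that is again a power of
  \<open>t\<close>. Estimates of the mass from either side reduce to this case by
  monotonicity.\<close>

lemma wolff_integrand_powr:
  assumes "t > 0" "C \<ge> 0"
  shows "enn_powr (ennreal (C * t powr m) / ennreal (t powr l)) e / ennreal t
    = ennreal (C powr e * t powr ((m - l) * e - 1))"
  using assms
  by (simp add: divide_ennreal enn_powr_ennreal powr_mult powr_powr powr_diff powr_divide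
      left_diff_distrib)

section \<open>Comparison of Wolff potentials with powers: lower bounds, then the upper
  bound\<close>

text \<open>An increasing power is smallest at \<open>T\<close>, a decreasing one at
  \<open>L * T\<close>. The minimum covers both, so the sign of the exponent never has to be
  known.\<close>

lemma powr_ge_on_doubling:
  assumes "0 < T" "T \<le> t" "t \<le> L * T" "1 \<le> L"
  shows "min 1 (L powr a) * T powr a \<le> t powr (a::real)"
proof (cases "a \<ge> 0")
  case True
  have "min 1 (L powr a) * T powr a \<le> 1 * T powr a"
    by (intro mult_right_mono) auto
  also have "\<dots> \<le> t powr a"
    using assms True by (auto intro: powr_mono2)
  finally show ?thesis .
next
  case False
  have "min 1 (L powr a) * T powr a \<le> L powr a * T powr a"
    by (intro mult_right_mono) auto
  also have "\<dots> = (L * T) powr a"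
    using assms by (simp add: powr_mult)
  also have "\<dots> \<le> t powr a"
    using assms False by (auto intro: powr_mono2')
  finally show ?thesis .
qed

text \<open>Only radii in [T, 2T] are used, which avoids any measurability of the mass in t.\<close>
lemma wolff_ge:
  fixes f :: "real^'n \<Rightarrow> real" and \<beta> \<gamma> s c T :: real
  defines "e \<equiv> (\<beta> * \<gamma> - s) / (\<gamma> - 1)"
  assumes \<gamma>: "\<gamma> > 1" and c: "c > 0" and T: "T > 0"
    and mass: "\<And>t. T \<le> t \<Longrightarrow> t \<le> 2 * T \<Longrightarrow>
      ennreal (c * t powr (real CARD('n) - s)) \<le> (\<integral>\<^sup>+ y\<in>ball x t. ennreal (f y) \<partial>lebesgue)"
  shows "ennreal (c powr (1 / (\<gamma> - 1)) * min 1 (2 powr (e - 1)) * T powr e) \<le> wolff \<beta> \<gamma> f x"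
proof -
  let ?k = "1 / (\<gamma> - 1)" and ?l = "real CARD('n) - \<beta> * \<gamma>"
  \<comment> \<open>\<open>K\<close> bounds the integrand from below on [T, 2T]; the length
    \<open>T\<close> of this interval raises the exponent from \<open>e - 1\<close> to
    \<open>e\<close>.\<close>
  define K where "K = c powr ?k * (min 1 (2 powr (e - 1)) * T powr (e - 1))"
  have "ennreal K * indicator {T..2*T} t \<le>
      enn_powr ((\<integral>\<^sup>+ y\<in>ball x t. ennreal (f y) \<partial>lebesgue) / ennreal (t powr ?l)) ?k / ennreal t
        * indicator {0<..} t" for t :: real
  proof (cases "t \<in> {T..2*T}")
    case True
    then have t: "T \<le> t" "t \<le> 2 * T" "t > 0"
      using T by auto
    have "K \<le> c powr ?k * t powr (e - 1)"
      unfolding K_def using t T by (intro mult_left_mono powr_ge_on_doubling) auto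
    then have "ennreal K \<le> ennreal (c powr ?k * t powr (e - 1))"
      by (rule ennreal_leI)
    also have "\<dots> = enn_powr (ennreal (c * t powr (real CARD('n) - s)) / ennreal (t powr ?l)) ?k / ennreal t"
      using t c by (subst wolff_integrand_powr) (auto simp: e_def)
    also have "\<dots> \<le> enn_powr ((\<integral>\<^sup>+ y\<in>ball x t. ennreal (f y) \<partial>lebesgue) / ennreal (t powr ?l)) ?k / ennreal t"
      using \<gamma> by (intro divide_right_mono_ennreal enn_powr_mono mass t) auto
    finally show ?thesis
      using t by simp
  qed simp
  then have "(\<integral>\<^sup>+ t. ennreal K * indicator {T..2*T} t \<partial>lborel) \<le> wolff \<beta> \<gamma> f x"
    unfolding wolff_def by (intro nn_integral_mono)
  also have "(\<integral>\<^sup>+ t. ennreal K * indicator {T..2*T} t \<partial>lborel) = ennreal K * ennreal T"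
    using T by (subst nn_integral_cmult_indicator) auto
  also have "\<dots> = ennreal (c powr ?k * min 1 (2 powr (e - 1)) * T powr e)"
    using T by (subst ennreal_mult[symmetric]) (auto simp: K_def powr_diff)
  finally show ?thesis .
qed

text \<open>Taking \<open>T = L * (1 + norm x)\<close> turns a growth rate of the mass in the radius
  into a rate in \<open>x\<close>. The factor \<open>L\<close> leaves room for the ball around
  \<open>x\<close> to reach the region where the mass is found.\<close>

lemma wolff_ge_powr:
  fixes f :: "real^'n \<Rightarrow> real" and \<beta> \<gamma> s c L :: real
  assumes \<gamma>: "\<gamma> > 1" and c: "c > 0" and L: "L > 0"
    and mass: "\<And>x t. L * (1 + norm x) \<le> t \<Longrightarrow>
      ennreal (c * t powr (real CARD('n) - s)) \<le> (\<integral>\<^sup>+ y\<in>ball x t. ennreal (f y) \<partial>lebesgue)"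
  shows "\<exists>c'>0. \<forall>x. ennreal (c' * (1 + norm x) powr ((\<beta> * \<gamma> - s) / (\<gamma> - 1))) \<le> wolff \<beta> \<gamma> f x"
proof -
  define e where "e = (\<beta> * \<gamma> - s) / (\<gamma> - 1)"
  define c' where "c' = c powr (1 / (\<gamma> - 1)) * min 1 (2 powr (e - 1)) * L powr e"
  have "c' > 0"
    using c L by (simp add: c'_def)
  moreover have "ennreal (c' * (1 + norm x) powr e) \<le> wolff \<beta> \<gamma> f x" for x
  proof -
    have "ennreal (c powr (1 / (\<gamma> - 1)) * min 1 (2 powr (e - 1)) * (L * (1 + norm x)) powr e) \<le> wolff \<beta> \<gamma> f x"
      unfolding e_def using L
      by (intro wolff_ge \<gamma> c mass) (auto intro!: mult_pos_pos add_pos_nonneg)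
    then show ?thesis
      using L by (simp add: c'_def powr_mult mult_ac)
  qed
  ultimately show ?thesis
    unfolding e_def by blast
qed

text \<open>The mass of a ball of radius t is estimated on a small ball inside the shell t/4 < |y| < t/2,
  where both weights are comparable with powers of t.\<close>
lemma wolff_ge_of_ge_powr:
  fixes f :: "real^'n \<Rightarrow> real" and \<beta> \<gamma> \<sigma> r c :: real
  assumes \<gamma>: "\<gamma> > 1" and c: "c > 0"
    and f: "AE y in lebesgue. c * (norm y powr \<sigma> * (1 + norm y) powr (- r)) \<le> f y"
  shows "\<exists>c'>0. \<forall>x. ennreal (c' * (1 + norm x) powr ((\<beta> * \<gamma> + \<sigma> - r) / (\<gamma> - 1))) \<le> wolff \<beta> \<gamma> f x"
proof -
  let ?d = "real CARD('n)" and ?V = "unit_ball_vol (real CARD('n))"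
  \<comment> \<open>The constant of \<open>powr_ge_on_doubling\<close> on the range from
    \<open>t / 4\<close> to \<open>t\<close>, that is, with doubling factor 4.\<close>
  define m where "m a = min 1 (4 powr a) * (1/4) powr a" for a :: real
  have m: "m a > 0" for a
    by (simp add: m_def)
  have m_le: "m a * t powr a \<le> z powr a" if "t > 0" "t / 4 \<le> z" "z \<le> t" for a t z
    using powr_ge_on_doubling[of "t / 4" z 4 a] that by (simp add: m_def powr_divide)
  define c1 where "c1 = c * (m \<sigma> * m (- r)) * (?V * (1/8) powr ?d)"
  have "c1 > 0"
    using c m by (simp add: c1_def)
  moreover have "ennreal (c1 * t powr (?d - (r - \<sigma>))) \<le> (\<integral>\<^sup>+ y\<in>ball x t. ennreal (f y) \<partial>lebesgue)"
    if t: "4 * (1 + norm x) \<le> t" for x :: "real^'n" and t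
  proof -
    \<comment> \<open>The factor 4 serves twice: \<open>norm x \<le> t / 4\<close> puts all points
      of norm below \<open>t / 2\<close> into \<open>ball x t\<close>, and \<open>t \<ge> 4\<close>
      keeps \<open>1 + norm y\<close> below \<open>t\<close> for them.\<close>
    have t4: "t \<ge> 4"
      using t by (rule order_trans[rotated]) simp
    have tx: "norm x \<le> t / 4"
      using t by simp
    obtain z :: "real^'n" where z: "norm z = 3 * t / 8"
      using vector_choose_size[of "3 * t / 8"] t4 by auto
    define K where "K = c * (m \<sigma> * t powr \<sigma> * (m (- r) * t powr (- r)))"
    have "c1 * t powr (?d - (r - \<sigma>)) = K * (?V * (t / 8) powr ?d)"
      using t4 by (simp add: c1_def K_def powr_divide powr_diff powr_add powr_minus field_simps)
    then have "ennreal (c1 * t powr (?d - (r - \<sigma>))) = ennreal K * emeasure lebesgue (ball z (t / 8))"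
      using t4 c m[of \<sigma>] m[of "- r"] by (subst emeasure_lebesgue_ball) (auto simp: K_def ennreal_mult[symmetric])
    also have "\<dots> = (\<integral>\<^sup>+ y\<in>ball z (t / 8). ennreal K \<partial>lebesgue)"
      by (rule nn_integral_cmult_indicator[symmetric]) simp
    also have "\<dots> \<le> (\<integral>\<^sup>+ y\<in>ball x t. ennreal (f y) \<partial>lebesgue)"
      using f
    proof (intro nn_integral_mono_AE, elim eventually_mono)
      fix y assume fy: "c * (norm y powr \<sigma> * (1 + norm y) powr (- r)) \<le> f y"
      show "ennreal K * indicator (ball z (t / 8)) y \<le> ennreal (f y) * indicator (ball x t) y"
      proof (cases "y \<in> ball z (t / 8)")
        case True
        then have "norm (z - y) < t / 8"
          by (simp add: dist_norm)
        then have y: "t / 4 < norm y" "norm y < t / 2"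
          using z norm_triangle_ineq2[of z y] norm_triangle_ineq2[of y z]
          by (simp_all add: norm_minus_commute)
        have "dist x y < t"
          using y tx norm_triangle_ineq4[of x y] by (simp add: dist_norm)
        moreover have "K \<le> f y"
          unfolding K_def using fy c y t4 m[of \<sigma>] m[of "- r"]
          by (intro order_trans[OF _ fy] mult_left_mono mult_mono m_le) auto
        ultimately show ?thesis
          using True by (simp add: ennreal_leI)
      qed simp
    qed
    finally show ?thesis .
  qed
  ultimately show ?thesis
    using wolff_ge_powr[of \<gamma> c1 4 "r - \<sigma>" f \<beta>] \<gamma> by (simp add: algebra_simps)
qed

text \<open>Every ball around \<open>x\<close> of radius at least \<open>1 + norm x\<close> contains
  the unit ball, whose mass is positive; this is \<open>wolff_ge_powr\<close> with \<open>s\<close>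
  equal to the dimension. The origin is exempt because a weight \<open>norm y powr \<sigma>\<close>
  takes the value 0 there.\<close>

lemma wolff_ge_of_pos:
  fixes f :: "real^'n \<Rightarrow> real" and \<beta> \<gamma> :: real
  assumes \<gamma>: "\<gamma> > 1" and [measurable]: "f \<in> borel_measurable lebesgue"
    and pos: "\<And>y. y \<noteq> 0 \<Longrightarrow> f y > 0"
  shows "\<exists>c'>0. \<forall>x. ennreal (c' * (1 + norm x) powr ((\<beta> * \<gamma> - real CARD('n)) / (\<gamma> - 1))) \<le> wolff \<beta> \<gamma> f x"
proof -
  let ?g = "\<lambda>y. ennreal (f y) * indicator (ball 0 1) y"
  have g: "?g \<in> borel_measurable lebesgue"
    by (intro borel_measurable_times_ennreal borel_measurable_indicator) auto
  have "integral\<^sup>N lebesgue ?g \<noteq> 0"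
  proof
    assume "integral\<^sup>N lebesgue ?g = 0"
    then have "AE y in lebesgue. ?g y = 0"
      using nn_integral_0_iff_AE[OF g] by simp
    then have "ball (0::real^'n) 1 - {0} \<in> null_sets lebesgue"
      using pos by (subst AE_iff_null_sets) (auto elim!: eventually_mono simp: ennreal_eq_0_iff not_le[symmetric] split: split_indicator_asm)
    moreover have "{0::real^'n} \<in> null_sets lebesgue"
      by (simp flip: negligible_iff_null_sets)
    ultimately have "(ball (0::real^'n) 1 - {0}) \<union> {0} \<in> null_sets lebesgue"
      by (rule null_sets.Un)
    then have "ball (0::real^'n) 1 \<in> null_sets lebesgue"
      by (simp add: insert_absorb)
    then have "emeasure lebesgue (ball (0::real^'n) 1) = 0"
      by auto
    then show False
      using unit_ball_vol_pos[of "real CARD('n)"] by (subst (asm) emeasure_lebesgue_ball) auto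
  qed
  \<comment> \<open>Nothing so far excludes an infinite mass; capping it at 1 makes it a real
    constant.\<close>
  then have pos: "min 1 (integral\<^sup>N lebesgue ?g) > 0"
    by (simp add: zero_less_iff_neq_zero)
  have fin: "min 1 (integral\<^sup>N lebesgue ?g) < top"
    by (rule le_less_trans[OF min.cobounded1]) simp
  define c where "c = enn2real (min 1 (integral\<^sup>N lebesgue ?g))"
  have c: "c > 0" "ennreal c \<le> integral\<^sup>N lebesgue ?g"
    using pos fin by (simp_all add: c_def enn2real_positive_iff)
  show ?thesis
  proof (rule wolff_ge_powr[OF \<gamma> c(1), where L = 1])
    fix x :: "real^'n" and t :: real
    assume t: "1 * (1 + norm x) \<le> t"
    have "ball 0 1 \<subseteq> ball x t"
    proof
      fix y :: "real^'n" assume "y \<in> ball 0 1"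
      then show "y \<in> ball x t"
        using t norm_triangle_ineq4[of x y] by (simp add: dist_norm)
    qed
    then have "integral\<^sup>N lebesgue ?g \<le> (\<integral>\<^sup>+ y\<in>ball x t. ennreal (f y) \<partial>lebesgue)"
      by (intro nn_integral_mono) (auto split: split_indicator)
    moreover have "t > 0"
      by (rule less_le_trans[OF _ t]) (simp add: add_pos_nonneg)
    ultimately show "ennreal (c * t powr (real CARD('n) - real CARD('n))) \<le> (\<integral>\<^sup>+ y\<in>ball x t. ennreal (f y) \<partial>lebesgue)"
      using c by (simp add: order_trans)
  qed simp
qed

text \<open>The radii are split at R = (1 + |x|)/2: below R the factor 1 + |y| is at least R on the ball, above R
  the density is bounded by |y| to the power \<open>-s\<close>.\<close>
lemma wolff_le_of_le_powr:
  fixes f :: "real^'n \<Rightarrow> real" and \<beta> \<gamma> a s C :: real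
  assumes \<gamma>: "\<gamma> > 1" and C: "C > 0" and a: "0 \<le> a" "a < \<beta> * \<gamma>" and s: "\<beta> * \<gamma> < s" "s < real CARD('n)"
    and f: "AE y in lebesgue. f y \<le> C * (norm y powr (- a) * (1 + norm y) powr (a - s))"
  shows "\<exists>C'>0. \<forall>x. wolff \<beta> \<gamma> f x \<le> ennreal (C' * (1 + norm x) powr (- ((s - \<beta> * \<gamma>) / (\<gamma> - 1))))"
proof -
  let ?d = "real CARD('n)" and ?k = "1 / (\<gamma> - 1)" and ?l = "real CARD('n) - \<beta> * \<gamma>"
  define I where "I b x t = (\<integral>\<^sup>+ y\<in>ball (x::real^'n) t. ennreal (norm y powr (- b)) \<partial>lebesgue)" for b x t
  obtain K1 where K1: "K1 > 0" "\<And>x t. t > 0 \<Longrightarrow> I a x t \<le> ennreal (K1 * t powr (?d - a))"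
    using nn_integral_norm_powr_ball[of a, where 'a = "real^'n"] a s unfolding I_def by auto
  obtain K2 where K2: "K2 > 0" "\<And>x t. t > 0 \<Longrightarrow> I s x t \<le> ennreal (K2 * t powr (?d - s))"
    using nn_integral_norm_powr_ball[of s, where 'a = "real^'n"] a s unfolding I_def by auto
  define mass where "mass x t = (\<integral>\<^sup>+ y\<in>ball x t. ennreal (f y) \<partial>lebesgue)" for x t
  \<comment> \<open>Used with \<open>b = a\<close> for small radii, where the singularity of the
    weight counts, and with \<open>b = s\<close> for large ones, where the total decay
    counts.\<close>
  have mass_le: "mass x t \<le> ennreal D * I b x t"
    if D: "D \<ge> 0" and le: "\<And>y. y \<in> ball x t \<Longrightarrow> y \<noteq> 0 \<Longrightarrow> C * (norm y powr (- a) * (1 + norm y) powr (a - s)) \<le> D * norm y powr (- b)"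
    for D b x t
  proof -
    have "AE y in lebesgue. y \<noteq> (0::real^'n)"
      by (rule AE_I'[of "{0}"]) (auto simp flip: negligible_iff_null_sets)
    with f have "mass x t \<le> (\<integral>\<^sup>+ y. ennreal D * (ennreal (norm y powr (- b)) * indicator (ball x t) y) \<partial>lebesgue)"
      unfolding mass_def
    proof (intro nn_integral_mono_AE, eventually_elim)
      case (elim y)
      show ?case
      proof (cases "y \<in> ball x t")
        case True
        have "f y \<le> D * norm y powr (- b)"
          using elim le[OF True] by linarith
        then show ?thesis
          using True D by (simp add: ennreal_mult[symmetric] ennreal_leI)
      qed simp
    qed
    also have "\<dots> = ennreal D * I b x t"
      unfolding I_def by (intro nn_integral_cmult borel_measurable_lebesgue_ball) measurable
    finally show ?thesis .
  qed
  \<comment> \<open>\<open>e1 > 0\<close> gives convergence at small radii and comes from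
    \<open>a < \<beta> * \<gamma>\<close>; \<open>e2 > 0\<close> gives convergence at large radii
    and comes from \<open>\<beta> * \<gamma> < s\<close>.\<close>
  define e1 e2 where "e1 = (\<beta> * \<gamma> - a) / (\<gamma> - 1)" and "e2 = (s - \<beta> * \<gamma>) / (\<gamma> - 1)"
  have e: "e1 > 0" "e2 > 0"
    using a s \<gamma> by (auto simp: e1_def e2_def)
  define C1 where "C1 = (C * K1) powr ?k / e1 + (C * K2) powr ?k / e2"
  have C1: "C1 > 0"
    using C K1 K2 e by (simp add: C1_def add_pos_pos)
  have main: "wolff \<beta> \<gamma> f x \<le> ennreal (C1 * 2 powr e2 * (1 + norm x) powr (- e2))" for x
  proof -
    define R where "R = (1 + norm x) / 2"
    have R: "R > 0"
      by (auto simp: R_def add_pos_nonneg)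
    define A B where "A = (C * R powr (a - s) * K1) powr ?k" and "B = (C * K2) powr ?k"
    have AB: "A \<ge> 0" "B \<ge> 0"
      by (auto simp: A_def B_def)
    let ?h1 = "\<lambda>t. ennreal (t powr (e1 - 1)) * indicator {0..R} t"
    let ?h2 = "\<lambda>t. ennreal (t powr (- e2 - 1)) * indicator {R..} t"
    have bound: "enn_powr (mass x t / ennreal (t powr ?l)) ?k / ennreal t
        \<le> ennreal (D powr ?k * t powr ((m - ?l) * ?k - 1))"
      if "t > 0" "D \<ge> 0" "mass x t \<le> ennreal (D * t powr m)" for t D m
      using that \<gamma>
      by (subst wolff_integrand_powr[symmetric]) (auto intro!: divide_right_mono_ennreal enn_powr_mono)
    have "wolff \<beta> \<gamma> f x \<le> (\<integral>\<^sup>+ t. ennreal A * ?h1 t + ennreal B * ?h2 t \<partial>lborel)"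
      unfolding wolff_def mass_def[symmetric]
    proof (intro nn_integral_mono)
      fix t :: real
      consider "t \<le> 0" | "0 < t" "t \<le> R" | "R < t" by linarith
      then show "enn_powr (mass x t / ennreal (t powr ?l)) ?k / ennreal t * indicator {0<..} t
          \<le> ennreal A * ?h1 t + ennreal B * ?h2 t"
      proof cases
        case 2
        have "mass x t \<le> ennreal (C * R powr (a - s)) * I a x t"
        proof (rule mass_le)
          fix y assume "y \<in> ball x t"
          then have "norm (x - y) < R"
            using 2 by (simp add: dist_norm)
          then have "R \<le> 1 + norm y"
            using norm_triangle_ineq2[of x y] by (simp add: R_def field_simps)
          then have "(1 + norm y) powr (a - s) \<le> R powr (a - s)"
            using R a s by (intro powr_mono2') auto
          then show "C * (norm y powr (- a) * (1 + norm y) powr (a - s)) \<le> C * R powr (a - s) * norm y powr (- a)"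
            using mult_left_mono[of _ _ "norm y powr (- a)"] C
            by (simp add: mult.commute[of _ "norm y powr (- a)"])
        qed (use C in simp)
        also have "\<dots> \<le> ennreal (C * R powr (a - s)) * ennreal (K1 * t powr (?d - a))"
          using 2 by (intro mult_left_mono K1) auto
        also have "\<dots> = ennreal (C * R powr (a - s) * K1 * t powr (?d - a))"
          using C K1 by (simp add: ennreal_mult[symmetric] mult_ac)
        finally have "enn_powr (mass x t / ennreal (t powr ?l)) ?k / ennreal t \<le> ennreal (A * t powr (e1 - 1))"
          using bound[of t "C * R powr (a - s) * K1" "?d - a"] C K1 2
          by (simp add: A_def e1_def)
        also have "\<dots> = ennreal A * ennreal (t powr (e1 - 1))"
          using AB by (simp add: ennreal_mult)
        finally show ?thesis
          using 2 by (auto intro!: add_increasing2)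
      next
        case 3
        have "mass x t \<le> ennreal C * I s x t"
        proof (rule mass_le)
          fix y :: "real^'n" assume "y \<noteq> 0"
          have "(1 + norm y) powr (a - s) \<le> norm y powr (a - s)"
            using \<open>y \<noteq> 0\<close> a s by (intro powr_mono2') auto
          then have "norm y powr (- a) * (1 + norm y) powr (a - s) \<le> norm y powr (- a) * norm y powr (a - s)"
            by (rule mult_left_mono) simp
          also have "\<dots> = norm y powr (- s)"
            by (simp flip: powr_add)
          finally show "C * (norm y powr (- a) * (1 + norm y) powr (a - s)) \<le> C * norm y powr (- s)"
            using C by simp
        qed (use C in simp)
        also have "\<dots> \<le> ennreal C * ennreal (K2 * t powr (?d - s))"
          using 3 R by (intro mult_left_mono K2) auto
        also have "\<dots> = ennreal (C * K2 * t powr (?d - s))"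
          using C K2 by (simp add: ennreal_mult[symmetric] mult_ac)
        finally have "enn_powr (mass x t / ennreal (t powr ?l)) ?k / ennreal t
            \<le> ennreal (B * t powr ((?d - s - ?l) * ?k - 1))"
          using bound[of t "C * K2" "?d - s"] C K2 3 R by (simp add: B_def)
        also have "(?d - s - ?l) * ?k - 1 = - e2 - 1"
          using \<gamma> by (simp add: e2_def field_simps)
        also have "ennreal (B * t powr (- e2 - 1)) = ennreal B * ennreal (t powr (- e2 - 1))"
          using AB by (simp add: ennreal_mult)
        finally show ?thesis
          using 3 R by simp
      qed simp
    qed
    also have "\<dots> = ennreal A * ennreal (R powr e1 / e1) + ennreal B * ennreal (R powr (- e2) / e2)"
      using nn_integral_powr_0[OF e(1) R] nn_integral_powr_inf[OF e(2) R]
      by (subst nn_integral_add) (auto simp: nn_integral_cmult)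
    also have "\<dots> = ennreal (A * R powr e1 / e1 + B * R powr (- e2) / e2)"
      using AB e by (simp add: ennreal_mult[symmetric] flip: ennreal_plus)
    \<comment> \<open>The factor \<open>R powr (a - s)\<close> hidden in \<open>A\<close> makes the
      small radii contribute the same order \<open>R powr (- e2)\<close> as the large ones.\<close>
    also have "A * R powr e1 = (C * K1) powr ?k * R powr (- e2)"
    proof -
      have "A = (C * K1) powr ?k * R powr ((a - s) * ?k)"
        using C K1 R by (simp add: A_def powr_mult powr_powr)
      moreover have "(a - s) * ?k + e1 = - e2"
        by (simp add: e1_def e2_def minus_divide_left flip: add_divide_distrib)
      ultimately show ?thesis
        by (simp add: mult.assoc flip: powr_add)
    qed
    also have "(C * K1) powr ?k * R powr (- e2) / e1 + B * R powr (- e2) / e2 = C1 * R powr (- e2)"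
      by (simp add: C1_def B_def field_simps)
    also have "R powr (- e2) = 2 powr e2 * (1 + norm x) powr (- e2)"
      by (simp add: R_def powr_divide powr_minus field_simps)
    finally show ?thesis
      by (simp add: mult_ac)
  qed
  have "C1 * 2 powr e2 > 0"
    using C1 by simp
  with main show ?thesis
    unfolding e2_def by blast
qed

subsection \<open>Functions comparable with powers\<close>

text \<open>A null set contains no unit ball, and the unit ball around a point of norm
  \<open>\<bar>R\<bar> + 1\<close> lies entirely beyond radius \<open>R\<close>.\<close>

lemma AE_lebesgue_ex_norm_gt:
  fixes Q :: "'a::euclidean_space \<Rightarrow> bool"
  assumes "AE x in lebesgue. Q x"
  shows "\<exists>x. norm x > R \<and> Q x"
proof (rule ccontr)
  assume neg: "\<not> (\<exists>x. norm x > R \<and> Q x)"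
  obtain z :: 'a where z: "norm z = \<bar>R\<bar> + 1"
    using vector_choose_size[of "\<bar>R\<bar> + 1"] by auto
  have "norm x > R" if "x \<in> ball z 1" for x
    using that z norm_triangle_ineq2[of z x] by (simp add: dist_norm)
  with neg have "\<And>x. Q x \<Longrightarrow> x \<notin> ball z 1"
    by blast
  with assms have "AE x in lebesgue. x \<notin> ball z 1"
    by (auto elim: eventually_mono)
  then have "emeasure lebesgue (ball z 1) = 0"
    by (subst (asm) AE_iff_null_sets[symmetric]) auto
  then show False
    using unit_ball_vol_pos[of "real DIM('a)"] by (subst (asm) emeasure_lebesgue_ball) auto
qed

lemma not_AE_one_plus_norm_powr_le:
  assumes "e > 0"
  shows "\<not> (AE x in lebesgue. (1 + norm (x::'a::euclidean_space)) powr e \<le> M)"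
proof
  assume "AE x in lebesgue. (1 + norm (x::'a)) powr e \<le> M"
  from AE_lebesgue_ex_norm_gt[OF this] obtain x :: 'a
    where x: "norm x > max 1 M powr (1 / e)" "(1 + norm x) powr e \<le> M"
    by blast
  have "max 1 M = (max 1 M powr (1 / e)) powr e"
    using assms by (simp add: powr_powr)
  also have "\<dots> < (1 + norm x) powr e"
    using x assms by (intro powr_less_mono2) auto
  finally show False
    using x by simp
qed

text \<open>The function is the pointwise limit of its truncations to closed balls, each of which is
  integrable.\<close>

lemma locally_integrable_imp_measurable:
  assumes "locally_integrable f"
  shows "f \<in> borel_measurable lebesgue"
proof (rule borel_measurable_LIMSEQ_real)
  fix i :: nat
  have "set_integrable lebesgue (cball 0 (real i)) f"
    using assms by (simp add: locally_integrable_def)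
  then show "(\<lambda>x. indicator (cball 0 (real i)) x *\<^sub>R f x) \<in> borel_measurable lebesgue"
    unfolding set_integrable_def by (rule borel_measurable_integrable)
next
  fix x :: "real^'a"
  have "eventually (\<lambda>i. norm x \<le> real i) sequentially"
    using eventually_ge_at_top[of "nat \<lceil>norm x\<rceil>"] by eventually_elim linarith
  then have "eventually (\<lambda>i. indicator (cball 0 (real i)) x *\<^sub>R f x = f x) sequentially"
    by eventually_elim simp
  then show "(\<lambda>i. indicator (cball 0 (real i)) x *\<^sub>R f x) \<longlonglongrightarrow> f x"
    by (rule tendsto_eventually)
qed

text \<open>Only almost everywhere, as the equations of the system hold only there. The exponent may
  have any sign: the iteration drives it below zero.\<close>

definition ge_powr :: "('a::euclidean_space \<Rightarrow> real) \<Rightarrow> real \<Rightarrow> bool" where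
  "ge_powr w \<theta> \<longleftrightarrow> (\<exists>c>0. AE x in lebesgue. c * (1 + norm x) powr (- \<theta>) \<le> w x)"

definition le_powr :: "('a::euclidean_space \<Rightarrow> real) \<Rightarrow> real \<Rightarrow> bool" where
  "le_powr w \<theta> \<longleftrightarrow> (\<exists>C>0. AE x in lebesgue. w x \<le> C * (1 + norm x) powr (- \<theta>))"

lemma ge_powr_mono:
  assumes "ge_powr w \<theta>" "\<theta> \<le> \<theta>'"
  shows "ge_powr w \<theta>'"
proof -
  obtain c where c: "c > 0" "AE x in lebesgue. c * (1 + norm x) powr (- \<theta>) \<le> w x"
    using assms unfolding ge_powr_def by blast
  have "c * (1 + norm x) powr (- \<theta>') \<le> c * (1 + norm x) powr (- \<theta>)" for x :: 'a
    using c assms by (intro mult_left_mono powr_mono) auto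
  with c show ?thesis
    unfolding ge_powr_def by (blast intro: order_trans eventually_mono)
qed

lemma le_powr_mono:
  assumes "le_powr w \<theta>" "\<theta>' \<le> \<theta>"
  shows "le_powr w \<theta>'"
proof -
  obtain C where C: "C > 0" "AE x in lebesgue. w x \<le> C * (1 + norm x) powr (- \<theta>)"
    using assms unfolding le_powr_def by blast
  have "C * (1 + norm x) powr (- \<theta>) \<le> C * (1 + norm x) powr (- \<theta>')" for x :: 'a
    using C assms by (intro mult_left_mono powr_mono) auto
  with C show ?thesis
    unfolding le_powr_def by (blast intro: order_trans eventually_mono)
qed

text \<open>Otherwise the quotient of the two bounds would keep a positive power of
  \<open>1 + norm x\<close> bounded almost everywhere.\<close>

lemma ge_powr_le_powr_imp_le:
  fixes w :: "'a::euclidean_space \<Rightarrow> real"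
  assumes "ge_powr w \<theta>" "le_powr w \<theta>'"
  shows "\<theta>' \<le> \<theta>"
proof (rule ccontr)
  assume less: "\<not> \<theta>' \<le> \<theta>"
  obtain c where c: "c > 0" "AE x in lebesgue. c * (1 + norm x) powr (- \<theta>) \<le> w x"
    using assms unfolding ge_powr_def by blast
  obtain C where C: "C > 0" "AE x in lebesgue. w x \<le> C * (1 + norm x) powr (- \<theta>')"
    using assms unfolding le_powr_def by blast
  have "AE x in lebesgue. (1 + norm (x::'a)) powr (\<theta>' - \<theta>) \<le> C / c"
    using c(2) C(2)
  proof eventually_elim
    case (elim x)
    have pos: "1 + norm x > 0"
      by (simp add: add_pos_nonneg)
    have "c * (1 + norm x) powr (- \<theta>) \<le> C * (1 + norm x) powr (- \<theta>')"
      using elim by linarith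
    then have "c * (1 + norm x) powr (- \<theta>) * (1 + norm x) powr \<theta>' \<le> C * (1 + norm x) powr (- \<theta>') * (1 + norm x) powr \<theta>'"
      by (rule mult_right_mono) simp
    then have "c * (1 + norm x) powr (\<theta>' - \<theta>) \<le> C"
      using pos by (simp add: mult.assoc flip: powr_add)
    then show ?case
      using c by (simp add: field_simps)
  qed
  then show False
    using not_AE_one_plus_norm_powr_le[of "\<theta>' - \<theta>", where 'a = 'a] less by auto
qed

text \<open>The power of \<open>w\<close> to be integrated decays with exponent
  \<open>\<theta> * ?r\<close>, which exceeds the dimension because \<open>e < \<theta>\<close>.
  Here \<open>e\<close> stands for a critical exponent.\<close>

lemma in_Lp_of_le_powr:
  fixes w :: "real^'n \<Rightarrow> real"
  assumes "w \<in> borel_measurable lebesgue" "\<And>x. 0 \<le> w x" "le_powr w \<theta>" "0 < e" "e < \<theta>"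
  shows "in_Lp (real CARD('n) / e) w"
proof -
  let ?r = "real CARD('n) / e"
  obtain C where C: "C > 0" "AE x in lebesgue. w x \<le> C * (1 + norm x) powr (- \<theta>)"
    using assms(3) unfolding le_powr_def by blast
  have "(\<integral>\<^sup>+ x. ennreal (\<bar>w x\<bar> powr ?r) \<partial>lebesgue)
      \<le> (\<integral>\<^sup>+ x. ennreal (C powr ?r) * ennreal ((1 + norm (x::real^'n)) powr (- (\<theta> * ?r))) \<partial>lebesgue)"
    using C(2)
  proof (intro nn_integral_mono_AE, eventually_elim)
    case (elim x)
    have "\<bar>w x\<bar> powr ?r \<le> (C * (1 + norm x) powr (- \<theta>)) powr ?r"
      using elim assms by (intro powr_mono2) auto
    also have "\<dots> = C powr ?r * (1 + norm x) powr (- (\<theta> * ?r))"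
      using C by (simp add: powr_mult powr_powr)
    finally show ?case
      by (simp add: ennreal_mult[symmetric] ennreal_leI)
  qed
  also have "\<dots> = ennreal (C powr ?r) * (\<integral>\<^sup>+ x. ennreal ((1 + norm (x::real^'n)) powr (- (\<theta> * ?r))) \<partial>lebesgue)"
    by (intro nn_integral_cmult measurable_completion) measurable
  also have "\<dots> < \<infinity>"
  proof -
    have "real CARD('n) < \<theta> * ?r"
      using assms by (simp add: field_simps)
    then show ?thesis
      using nn_integral_one_plus_norm_powr_finite[of "\<theta> * ?r", where 'a = "real^'n"]
      by (simp add: ennreal_mult_less_top)
  qed
  finally show ?thesis
    using assms by (simp add: in_Lp_def)
qed

text \<open>\<open>sim_pow\<close> controls only large \<open>norm x\<close>; inside radius
  \<open>S\<close> the bound \<open>M\<close> takes over. Since \<open>S \<ge> 1\<close>, replacing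
  \<open>norm x\<close> by \<open>1 + norm x\<close> outside costs a factor
  \<open>2 powr \<theta>\<close>.\<close>

lemma le_powr_of_sim_pow:
  fixes w :: "real^'n \<Rightarrow> real"
  assumes sim: "sim_pow w \<theta>" and \<theta>: "\<theta> > 0" and M: "\<And>x. w x \<le> M" "M > 0"
  shows "le_powr w \<theta>"
proof -
  obtain c R where c: "c > 0" and R: "\<And>x. R \<le> norm x \<Longrightarrow> norm x powr \<theta> * w x \<le> c"
    using sim unfolding sim_pow_def by blast
  define S where "S = max 1 R"
  define K where "K = c * 2 powr \<theta> + M * (1 + S) powr \<theta>"
  have "w x \<le> K * (1 + norm x) powr (- \<theta>)" for x
  proof -
    have pos: "1 + norm x > 0"
      by (simp add: add_pos_nonneg)
    have "(1 + norm x) powr \<theta> * w x \<le> K"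
    proof (cases "S \<le> norm x")
      case True
      then have x: "1 \<le> norm x" "R \<le> norm x"
        by (auto simp: S_def)
      show ?thesis
      proof (cases "w x \<le> 0")
        case True
        then have "(1 + norm x) powr \<theta> * w x \<le> 0"
          by (intro mult_nonneg_nonpos) auto
        also have "0 \<le> K"
          using c M by (simp add: K_def)
        finally show ?thesis .
      next
        case False
        have "(1 + norm x) powr \<theta> \<le> (2 * norm x) powr \<theta>"
          using x \<theta> by (intro powr_mono2) auto
        then have "(1 + norm x) powr \<theta> * w x \<le> (2 * norm x) powr \<theta> * w x"
          using False by (intro mult_right_mono) auto
        also have "\<dots> = 2 powr \<theta> * (norm x powr \<theta> * w x)"
          by (simp add: powr_mult)
        also have "\<dots> \<le> 2 powr \<theta> * c"
          using R[OF x(2)] by (intro mult_left_mono) auto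
        also have "\<dots> \<le> K"
          using M by (simp add: K_def)
        finally show ?thesis .
      qed
    next
      case False
      have "(1 + norm x) powr \<theta> * w x \<le> (1 + norm x) powr \<theta> * M"
        using M by (intro mult_left_mono) auto
      also have "\<dots> \<le> (1 + S) powr \<theta> * M"
        using False \<theta> M pos by (intro mult_right_mono powr_mono2) auto
      also have "\<dots> \<le> K"
        using c by (simp add: K_def)
      finally show ?thesis .
    qed
    then show ?thesis
      using pos by (simp add: powr_minus field_simps)
  qed
  moreover have "K > 0"
    using c M by (simp add: K_def add_pos_nonneg)
  ultimately show ?thesis
    unfolding le_powr_def by auto
qed

text \<open>Pointwise positivity would give no uniform lower bound near the origin. The auxiliary
  bound with exponent \<open>\<kappa>\<close> provides one inside radius \<open>S\<close>.\<close>

lemma ge_powr_of_sim_pow: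
  fixes w :: "real^'n \<Rightarrow> real"
  assumes sim: "sim_pow w \<theta>" and \<theta>: "\<theta> > 0" and w: "ge_powr w \<kappa>" and \<kappa>: "\<kappa> > 0"
  shows "ge_powr w \<theta>"
proof -
  obtain c R where c: "c > 0" and R: "\<And>x. R \<le> norm x \<Longrightarrow> 1 / c \<le> norm x powr \<theta> * w x"
    using sim unfolding sim_pow_def by blast
  obtain b where b: "b > 0" "AE x in lebesgue. b * (1 + norm x) powr (- \<kappa>) \<le> w x"
    using w unfolding ge_powr_def by blast
  define S where "S = max 1 R"
  define K where "K = min (1 / c) (b * (1 + S) powr (- \<kappa>))"
  have "K > 0"
    using c b by (auto simp: K_def S_def)
  moreover have "AE x in lebesgue. K * (1 + norm x) powr (- \<theta>) \<le> w x"
    using b(2)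
  proof eventually_elim
    case (elim x)
    show ?case
    proof (cases "S \<le> norm x")
      case True
      then have x: "1 \<le> norm x" "R \<le> norm x"
        by (auto simp: S_def)
      have "K * (1 + norm x) powr (- \<theta>) \<le> 1 / c * norm x powr (- \<theta>)"
        using x \<theta> c by (intro mult_mono powr_mono2') (auto simp: K_def)
      also have "\<dots> \<le> (norm x powr \<theta> * w x) * norm x powr (- \<theta>)"
        using R[OF x(2)] by (intro mult_right_mono) auto
      also have "\<dots> = w x"
        using x by (auto simp: powr_minus field_simps)
      finally show ?thesis .
    next
      case False
      have "K * (1 + norm x) powr (- \<theta>) \<le> K * 1"
        using \<open>K > 0\<close> \<theta> powr_mono[of "- \<theta>" 0 "1 + norm x"]
        by (intro mult_left_mono) (auto simp: add_nonneg_eq_0_iff)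
      also have "\<dots> \<le> b * (1 + S) powr (- \<kappa>)"
        by (simp add: K_def)
      also have "\<dots> \<le> b * (1 + norm x) powr (- \<kappa>)"
        using False b \<kappa> by (intro mult_left_mono powr_mono2') (auto simp: add_pos_nonneg)
      also note elim
      finally show ?thesis .
    qed
  qed
  ultimately show ?thesis
    unfolding ge_powr_def by blast
qed

subsection \<open>Solutions of the system\<close>

text \<open>Exchanging the two equations exchanges the critical exponents, so results need to be
  proved for \<open>u\<close> only.\<close>

lemma p0_eq_q0_swap: "p0 \<beta> \<gamma> p q \<sigma>\<^sub>1 \<sigma>\<^sub>2 = q0 \<beta> \<gamma> q p \<sigma>\<^sub>2 \<sigma>\<^sub>1"
  by (simp add: p0_def q0_def mult.commute)

text \<open>Clearing the common denominator leaves a polynomial identity. Read as a map of decay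
  rates, one step through the first equation sends \<open>p0\<close> exactly to
  \<open>q0\<close>.\<close>

lemma q0_relation:
  assumes "p * q \<noteq> (\<gamma> - 1)^2"
  shows "(\<gamma> - 1) * q0 \<beta> \<gamma> p q \<sigma>\<^sub>1 \<sigma>\<^sub>2 = q * p0 \<beta> \<gamma> p q \<sigma>\<^sub>1 \<sigma>\<^sub>2 - \<beta> * \<gamma> - \<sigma>\<^sub>1"
proof -
  define D where "D = p * q - (\<gamma> - 1)^2"
  have D: "D \<noteq> 0"
    using assms by (simp add: D_def)
  have "(\<gamma> - 1) * (\<beta> * \<gamma> * (\<gamma> - 1 + q) + (\<gamma> - 1) * \<sigma>\<^sub>1 + \<sigma>\<^sub>2 * q)
      = q * (\<beta> * \<gamma> * (\<gamma> - 1 + p) + (\<gamma> - 1) * \<sigma>\<^sub>2 + \<sigma>\<^sub>1 * p) - (\<beta> * \<gamma> + \<sigma>\<^sub>1) * D"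
    unfolding D_def by algebra
  then show ?thesis
    using D unfolding p0_def q0_def D_def[symmetric] by (simp add: field_simps)
qed

text \<open>The numerator regroups into
  \<open>(\<gamma> - 1) * (\<beta> * \<gamma> + \<sigma>\<^sub>1)\<close> and
  \<open>q * (\<beta> * \<gamma> + \<sigma>\<^sub>2)\<close>, both positive.\<close>

lemma q0_pos:
  assumes "\<gamma> > 1" "q > 0" "p * q > (\<gamma> - 1)^2" "\<sigma>\<^sub>1 > - \<beta> * \<gamma>" "\<sigma>\<^sub>2 > - \<beta> * \<gamma>"
  shows "q0 \<beta> \<gamma> p q \<sigma>\<^sub>1 \<sigma>\<^sub>2 > 0"
proof -
  have "\<beta> * \<gamma> + \<sigma>\<^sub>1 > 0" "\<beta> * \<gamma> + \<sigma>\<^sub>2 > 0"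
    using assms by simp_all
  then have "0 < (\<gamma> - 1) * (\<beta> * \<gamma> + \<sigma>\<^sub>1) + q * (\<beta> * \<gamma> + \<sigma>\<^sub>2)"
    using assms(1,2) by (simp add: add_pos_pos)
  also have "\<dots> = \<beta> * \<gamma> * (\<gamma> - 1 + q) + (\<gamma> - 1) * \<sigma>\<^sub>1 + \<sigma>\<^sub>2 * q"
    by algebra
  finally show ?thesis
    using assms by (simp add: q0_def)
qed

text \<open>The hypotheses are symmetric under exchange of the two equations, with one bound
  \<open>M\<close> for both functions, so interpreting the locale with swapped roles yields the
  statements for \<open>v\<close>.\<close>

locale wolff_system =
  fixes \<beta> \<gamma> p q \<sigma>\<^sub>1 \<sigma>\<^sub>2 M :: real and c\<^sub>1 c\<^sub>2 u v :: "real^'n \<Rightarrow> real"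
  assumes gamma: "\<gamma> > 1" and beta: "\<beta> > 0" and bg: "\<beta> * \<gamma> < real CARD('n)"
    and pq_pos: "p > 0" "q > 0" and pq: "p * q > (\<gamma> - 1)^2"
    and sigma: "\<sigma>\<^sub>1 > - \<beta> * \<gamma>" "\<sigma>\<^sub>2 > - \<beta> * \<gamma>"
    and dbl: "double_bounded c\<^sub>1" "double_bounded c\<^sub>2"
    and sol: "wolff_solution \<beta> \<gamma> p q \<sigma>\<^sub>1 \<sigma>\<^sub>2 c\<^sub>1 c\<^sub>2 u v"
    and pos: "\<And>x. u x > 0" "\<And>x. v x > 0"
    and bdd: "\<And>x. u x \<le> M" "\<And>x. v x \<le> M"
begin

abbreviation "Q \<equiv> q0 \<beta> \<gamma> p q \<sigma>\<^sub>1 \<sigma>\<^sub>2"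
abbreviation "P \<equiv> p0 \<beta> \<gamma> p q \<sigma>\<^sub>1 \<sigma>\<^sub>2"

lemma swap: "wolff_system \<beta> \<gamma> q p \<sigma>\<^sub>2 \<sigma>\<^sub>1 M c\<^sub>2 c\<^sub>1 v u"
  using gamma beta bg pq_pos pq sigma dbl sol pos bdd
  by unfold_locales (auto simp: wolff_solution_def mult.commute)

lemma relations: "(\<gamma> - 1) * Q = q * P - \<beta> * \<gamma> - \<sigma>\<^sub>1" "(\<gamma> - 1) * P = p * Q - \<beta> * \<gamma> - \<sigma>\<^sub>2"
  using q0_relation[of p q \<gamma> \<beta> \<sigma>\<^sub>1 \<sigma>\<^sub>2] q0_relation[of q p \<gamma> \<beta> \<sigma>\<^sub>2 \<sigma>\<^sub>1] pq
  by (simp_all add: p0_eq_q0_swap mult.commute)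

lemma Q_pos: "Q > 0"
  using gamma pq_pos pq sigma by (rule_tac q0_pos) auto

lemma M_pos: "M > 0"
  using pos(1) bdd(1) less_le_trans by blast

lemma measurable_uv: "u \<in> borel_measurable lebesgue" "v \<in> borel_measurable lebesgue"
  using sol by (auto simp: wolff_solution_def intro: locally_integrable_imp_measurable)

lemma u_eq: "AE x in lebesgue. ennreal (u x) =
    ennreal (c\<^sub>1 x) * wolff \<beta> \<gamma> (\<lambda>y. norm y powr \<sigma>\<^sub>1 * v y powr q) x"
  using sol by (simp add: wolff_solution_def)

section \<open>Transfer of power bounds through one equation\<close>

lemma ge_powr_u_of_wolff:
  assumes "\<exists>c>0. \<forall>x. ennreal (c * (1 + norm x) powr e) \<le> wolff \<beta> \<gamma> (\<lambda>y. norm y powr \<sigma>\<^sub>1 * v y powr q) x"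
  shows "ge_powr u (- e)"
proof -
  obtain c where c: "c > 0" "\<And>x. ennreal (c * (1 + norm x) powr e) \<le> wolff \<beta> \<gamma> (\<lambda>y. norm y powr \<sigma>\<^sub>1 * v y powr q) x"
    using assms by blast
  obtain C where C: "C > 0" "\<And>x. 1 / C \<le> c\<^sub>1 x"
    using dbl(1) unfolding double_bounded_def by blast
  have "AE x in lebesgue. 1 / C * c * (1 + norm x) powr e \<le> u x"
    using u_eq
  proof eventually_elim
    case (elim x)
    have "ennreal (1 / C * c * (1 + norm x) powr e) = ennreal (1 / C) * ennreal (c * (1 + norm x) powr e)"
      using C c by (simp add: ennreal_mult[symmetric] mult.assoc)
    also have "\<dots> \<le> ennreal (u x)"
      unfolding elim using C c by (intro mult_mono ennreal_leI) auto
    finally show ?case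
      using pos(1)[of x] by (simp add: ennreal_le_iff)
  qed
  then show ?thesis
    unfolding ge_powr_def using c C by (intro exI[of _ "1 / C * c"]) auto
qed

lemma le_powr_u_of_wolff:
  assumes "\<exists>c>0. \<forall>x. wolff \<beta> \<gamma> (\<lambda>y. norm y powr \<sigma>\<^sub>1 * v y powr q) x \<le> ennreal (c * (1 + norm x) powr (- e))"
  shows "le_powr u e"
proof -
  obtain c where c: "c > 0" "\<And>x. wolff \<beta> \<gamma> (\<lambda>y. norm y powr \<sigma>\<^sub>1 * v y powr q) x \<le> ennreal (c * (1 + norm x) powr (- e))"
    using assms by blast
  obtain C where C: "C > 0" "\<And>x. c\<^sub>1 x \<le> C"
    using dbl(1) unfolding double_bounded_def by blast
  have "AE x in lebesgue. u x \<le> C * c * (1 + norm x) powr (- e)"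
    using u_eq
  proof eventually_elim
    case (elim x)
    have "ennreal (u x) \<le> ennreal C * ennreal (c * (1 + norm x) powr (- e))"
      unfolding elim using C c by (intro mult_mono ennreal_leI) auto
    also have "\<dots> = ennreal (C * c * (1 + norm x) powr (- e))"
      using C c by (simp add: ennreal_mult[symmetric] mult.assoc)
    finally show ?case
      using C c by (subst (asm) ennreal_le_iff) auto
  qed
  then show ?thesis
    unfolding le_powr_def using c C by (intro exI[of _ "C * c"]) auto
qed

text \<open>The bound on \<open>v\<close> makes the density at least a multiple of \<open>norm y
  powr \<sigma>\<^sub>1 * (1 + norm y) powr (- (q * \<theta>))\<close>. The step is available for
  every real \<open>\<theta>\<close>, so it can be iterated freely.\<close>

lemma ge_powr_step:
  assumes "ge_powr v \<theta>"
  shows "ge_powr u ((q * \<theta> - \<beta> * \<gamma> - \<sigma>\<^sub>1) / (\<gamma> - 1))"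
proof -
  obtain c where c: "c > 0" "AE y in lebesgue. c * (1 + norm y) powr (- \<theta>) \<le> v y"
    using assms unfolding ge_powr_def by blast
  have "AE y in lebesgue. c powr q * (norm y powr \<sigma>\<^sub>1 * (1 + norm y) powr (- (q * \<theta>))) \<le> norm y powr \<sigma>\<^sub>1 * v y powr q"
    using c(2)
  proof eventually_elim
    case (elim y)
    have "(c * (1 + norm y) powr (- \<theta>)) powr q \<le> v y powr q"
      using elim c pq_pos by (intro powr_mono2) auto
    then have "c powr q * (1 + norm y) powr (- (q * \<theta>)) \<le> v y powr q"
      using c by (simp add: powr_mult powr_powr mult.commute)
    from mult_left_mono[OF this, of "norm y powr \<sigma>\<^sub>1"] show ?case
      by (simp add: mult_ac)
  qed
  from wolff_ge_of_ge_powr[OF gamma _ this] c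
  have "ge_powr u (- ((\<beta> * \<gamma> + \<sigma>\<^sub>1 - q * \<theta>) / (\<gamma> - 1)))"
    by (intro ge_powr_u_of_wolff) auto
  then show ?thesis
    by (simp add: minus_divide_left algebra_simps)
qed

text \<open>The mass of the density in the unit ball alone forces this rate.\<close>

lemma ge_powr_universal: "ge_powr u ((real CARD('n) - \<beta> * \<gamma>) / (\<gamma> - 1))"
proof -
  have "ge_powr u (- ((\<beta> * \<gamma> - real CARD('n)) / (\<gamma> - 1)))"
  proof (intro ge_powr_u_of_wolff wolff_ge_of_pos gamma)
    have "(\<lambda>y::real^'n. norm y) \<in> borel_measurable lebesgue"
      by (intro measurable_completion) simp
    with measurable_uv(2) show "(\<lambda>y. norm y powr \<sigma>\<^sub>1 * v y powr q) \<in> borel_measurable lebesgue"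
      by simp
  next
    fix y :: "real^'n" assume "y \<noteq> 0"
    then show "0 < norm y powr \<sigma>\<^sub>1 * v y powr q"
      using pos(2)[of y] by simp
  qed
  then show ?thesis
    by (simp add: minus_divide_left)
qed

text \<open>The density decays at the rate \<open>s = q * \<theta> - \<sigma>\<^sub>1\<close>. The
  two inequalities on \<open>s\<close> are those of \<open>wolff_le_of_le_powr\<close>, and the
  exponent changes as in \<open>ge_powr_step\<close>.\<close>

lemma le_powr_step:
  assumes "le_powr v \<theta>" and "\<beta> * \<gamma> < q * \<theta> - \<sigma>\<^sub>1" "q * \<theta> - \<sigma>\<^sub>1 < real CARD('n)"
  shows "le_powr u ((q * \<theta> - \<beta> * \<gamma> - \<sigma>\<^sub>1) / (\<gamma> - 1))"
proof -
  obtain C where C: "C > 0" "AE y in lebesgue. v y \<le> C * (1 + norm y) powr (- \<theta>)"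
    using assms unfolding le_powr_def by blast
  \<comment> \<open>The order of the singularity of the weight at the origin, below
    \<open>\<beta> * \<gamma>\<close> by the condition on \<open>\<sigma>\<^sub>1\<close>.\<close>
  define a where "a = max 0 (- \<sigma>\<^sub>1)"
  define s where "s = q * \<theta> - \<sigma>\<^sub>1"
  have a: "0 \<le> a" "a < \<beta> * \<gamma>"
    using sigma gamma beta by (auto simp: a_def)
  \<comment> \<open>a positive power of |y| is absorbed into 1 + |y|, so only singular weights remain\<close>
  have weight: "norm y powr \<sigma>\<^sub>1 * (1 + norm y) powr (- (q * \<theta>)) \<le> norm y powr (- a) * (1 + norm y) powr (a - s)"
    for y :: "real^'n"
  \<comment> \<open>For nonpositive \<open>\<sigma>\<^sub>1\<close> the two sides coincide; at
    \<open>y = 0\<close> both are 0, since \<open>0 powr x\<close> is 0 for every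
    \<open>x\<close>.\<close>
  proof (cases "\<sigma>\<^sub>1 \<le> 0 \<or> y = 0")
    case False
    then have "norm y powr \<sigma>\<^sub>1 * (1 + norm y) powr (- (q * \<theta>)) \<le> (1 + norm y) powr \<sigma>\<^sub>1 * (1 + norm y) powr (- (q * \<theta>))"
      by (intro mult_right_mono powr_mono2) auto
    also have "\<dots> = (1 + norm y) powr (\<sigma>\<^sub>1 - q * \<theta>)"
      by (simp flip: powr_add)
    finally show ?thesis
      using False by (simp add: a_def s_def)
  qed (auto simp: a_def s_def)
  have "AE y in lebesgue. norm y powr \<sigma>\<^sub>1 * v y powr q \<le> C powr q * (norm y powr (- a) * (1 + norm y) powr (a - s))"
    using C(2)
  proof eventually_elim
    case (elim y)
    have "v y powr q \<le> (C * (1 + norm y) powr (- \<theta>)) powr q"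
      using elim pos(2)[of y] pq_pos by (intro powr_mono2) auto
    also have "\<dots> = C powr q * (1 + norm y) powr (- (q * \<theta>))"
      using C by (simp add: powr_mult powr_powr mult.commute)
    finally have "norm y powr \<sigma>\<^sub>1 * v y powr q \<le> norm y powr \<sigma>\<^sub>1 * (C powr q * (1 + norm y) powr (- (q * \<theta>)))"
      by (rule mult_left_mono) simp
    also have "\<dots> = C powr q * (norm y powr \<sigma>\<^sub>1 * (1 + norm y) powr (- (q * \<theta>)))"
      by simp
    also have "\<dots> \<le> C powr q * (norm y powr (- a) * (1 + norm y) powr (a - s))"
      by (intro mult_left_mono weight) simp
    finally show ?case .
  qed
  from wolff_le_of_le_powr[OF gamma _ a _ _ this] C assms
  have "le_powr u ((s - \<beta> * \<gamma>) / (\<gamma> - 1))"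
    by (intro le_powr_u_of_wolff) (auto simp: s_def)
  then show ?thesis
    by (simp add: s_def algebra_simps)
qed

section \<open>Exclusion of decay rates other than the critical one\<close>

lemma not_ge_powr_u:
  assumes "\<theta> < Q"
  shows "\<not> ge_powr u \<theta>"
proof
  assume "ge_powr u \<theta>"
  interpret swapped: wolff_system \<beta> \<gamma> q p \<sigma>\<^sub>2 \<sigma>\<^sub>1 M c\<^sub>2 c\<^sub>1 v u
    by (rule swap)
  define k where "k = \<gamma> - 1"
  define L where "L = p * q / k^2"
  have k: "k > 0"
    using gamma by (simp add: k_def)
  have L: "L > 1"
    using pq k by (simp add: L_def k_def)
  \<comment> \<open>In terms of the gap \<open>d\<close> to the critical exponent the affine map of
    exponents becomes linear, with factor \<open>p / k\<close> through one equation and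
    \<open>q / k\<close> through the other.\<close>
  have step: "ge_powr u (Q - L * d)" if "ge_powr u (Q - d)" for d
  proof -
    have "ge_powr v ((p * (Q - d) - \<beta> * \<gamma> - \<sigma>\<^sub>2) / k)"
      using swapped.ge_powr_step[OF that] by (simp add: k_def)
    also have "(p * (Q - d) - \<beta> * \<gamma> - \<sigma>\<^sub>2) / k = P - p / k * d"
      using k relations(2) by (simp add: field_simps k_def)
    finally have "ge_powr u ((q * (P - p / k * d) - \<beta> * \<gamma> - \<sigma>\<^sub>1) / k)"
      using ge_powr_step by (simp add: k_def)
    also have "(q * (P - p / k * d) - \<beta> * \<gamma> - \<sigma>\<^sub>1) / k = (k * Q - q * (p / k * d)) / k"
      using relations(1) by (simp add: right_diff_distrib k_def)
    also have "\<dots> = Q - L * d"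
      using k by (simp add: L_def power2_eq_square field_simps)
    finally show ?thesis .
  qed
  have iter: "ge_powr u (Q - L ^ j * (Q - \<theta>))" for j
  proof (induction j)
    case 0
    then show ?case using \<open>ge_powr u \<theta>\<close> by simp
  next
    case (Suc j)
    from step[OF this] show ?case
      by (simp add: mult.assoc)
  qed
  obtain j where "Q / (Q - \<theta>) < L ^ j"
    using real_arch_pow[OF L] by blast
  then have "Q - L ^ j * (Q - \<theta>) < 0"
    using assms by (simp add: field_simps)
  \<comment> \<open>Boundedness is the upper bound with exponent 0; it clashes with a lower bound of
    negative exponent.\<close>
  moreover have "le_powr u 0"
    using M_pos bdd(1) unfolding le_powr_def by (intro exI[of _ M]) (auto simp: add_nonneg_eq_0_iff)
  ultimately show False
    using ge_powr_le_powr_imp_le[OF iter, of 0 j] by simp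
qed

lemma integrable_pair_of_le_powr_u:
  assumes "\<theta> > Q" "le_powr u \<theta>"
  shows "integrable_pair \<beta> \<gamma> p q \<sigma>\<^sub>1 \<sigma>\<^sub>2 u v"
proof -
  interpret swapped: wolff_system \<beta> \<gamma> q p \<sigma>\<^sub>2 \<sigma>\<^sub>1 M c\<^sub>2 c\<^sub>1 v u
    by (rule swap)
  have P_pos: "P > 0"
    using swapped.Q_pos by (simp add: p0_eq_q0_swap)
  define k where "k = \<gamma> - 1"
  have k: "k > 0"
    using gamma by (simp add: k_def)
  show ?thesis
  proof (cases "k * P < real CARD('n) - \<beta> * \<gamma>")
    case True
    \<comment> \<open>With this \<open>d\<close>, raising the exponent of \<open>u\<close> by
      \<open>d\<close> uses half of the room below the dimension:
      \<open>p * (Q + d) - \<sigma>\<^sub>2\<close> is the mean of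
      \<open>p * Q - \<sigma>\<^sub>2\<close> and the dimension. The minimum in
      \<open>\<theta>'\<close> keeps the assumed bound on \<open>u\<close> applicable.\<close>
    define d where "d = (real CARD('n) - \<beta> * \<gamma> - k * P) / (2 * p)"
    define \<theta>' where "\<theta>' = min \<theta> (Q + d)"
    have d: "d > 0"
      using True pq_pos by (simp add: d_def)
    have \<theta>': "Q < \<theta>'" "\<theta>' \<le> Q + d"
      using assms d by (auto simp: \<theta>'_def)
    have gt: "p * Q < p * \<theta>'"
      using \<theta>' pq_pos by simp
    have "p * \<theta>' \<le> p * (Q + d)"
      using \<theta>' pq_pos by (intro mult_left_mono) auto
    also have "\<dots> = p * Q + (real CARD('n) - \<beta> * \<gamma> - k * P) / 2"
      using pq_pos by (simp add: d_def distrib_left)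
    finally have "p * \<theta>' - \<sigma>\<^sub>2 < real CARD('n)"
      using relations(2) True unfolding k_def[symmetric] by argo
    moreover have "\<beta> * \<gamma> < p * \<theta>' - \<sigma>\<^sub>2"
      using relations(2) gt mult_pos_pos[OF k P_pos] unfolding k_def[symmetric] by argo
    moreover have "le_powr u \<theta>'"
      by (rule le_powr_mono[OF assms(2)]) (simp add: \<theta>'_def)
    ultimately have "le_powr v ((p * \<theta>' - \<beta> * \<gamma> - \<sigma>\<^sub>2) / k)"
      unfolding k_def by (intro swapped.le_powr_step)
    moreover have "P < (p * \<theta>' - \<beta> * \<gamma> - \<sigma>\<^sub>2) / k"
      using relations(2) gt k unfolding k_def[symmetric] by (simp add: field_simps)
    ultimately show ?thesis
      unfolding integrable_pair_def using assms Q_pos P_pos pos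
      by (intro conjI in_Lp_of_le_powr measurable_uv) (auto intro: less_imp_le)
  next
    case False
    have "ge_powr v ((real CARD('n) - \<beta> * \<gamma>) / k)"
      using swapped.ge_powr_universal by (simp add: k_def)
    \<comment> \<open>Weakening the exponent to exactly \<open>P\<close> is deliberate: one step
      then gives exactly \<open>Q\<close> for \<open>u\<close>, against \<open>\<theta> > Q\<close>,
      so this case is impossible.\<close>
    then have "ge_powr v P"
      by (rule ge_powr_mono) (use False k in \<open>simp add: field_simps\<close>)
    from ge_powr_step[OF this] have "ge_powr u Q"
      unfolding relations(1)[symmetric] using gamma by simp
    from ge_powr_le_powr_imp_le[OF this assms(2)] assms(1) show ?thesis
      by simp
  qed
qed

text \<open>The lower half of \<open>sim_pow\<close>, made global, excludes rates below
  \<open>Q\<close>. The upper half with a rate above \<open>Q\<close> would make the pair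
  integrable.\<close>

lemma sim_pow_exponent_u:
  assumes "sim_pow u \<theta>" "\<theta> > 0" and "\<not> integrable_pair \<beta> \<gamma> p q \<sigma>\<^sub>1 \<sigma>\<^sub>2 u v"
  shows "\<theta> = Q"
proof -
  have "ge_powr u \<theta>"
    using gamma bg by (intro ge_powr_of_sim_pow[OF assms(1,2) ge_powr_universal]) simp
  then have "\<not> \<theta> < Q"
    using not_ge_powr_u by blast
  moreover have "le_powr u \<theta>"
    using bdd(1) M_pos by (rule le_powr_of_sim_pow[OF assms(1,2)])
  then have "\<not> Q < \<theta>"
    using integrable_pair_of_le_powr_u assms(3) by blast
  ultimately show ?thesis
    by linarith
qed

end

section \<open>Assembly of the three claims by symmetry\<close>

lemma integrable_pair_swap:
  "integrable_pair \<beta> \<gamma> q p \<sigma>\<^sub>2 \<sigma>\<^sub>1 v u \<longleftrightarrow> integrable_pair \<beta> \<gamma> p q \<sigma>\<^sub>1 \<sigma>\<^sub>2 u v"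
  by (auto simp: integrable_pair_def p0_eq_q0_swap)

theorem theorem4:
  fixes u v c\<^sub>1 c\<^sub>2 :: "real^'n \<Rightarrow> real"
    and \<beta> \<gamma> p q \<sigma>\<^sub>1 \<sigma>\<^sub>2 :: real
  assumes "CARD('n) \<ge> 3"
    and "\<beta> > 0" and "\<gamma> > 1" and "\<beta> * \<gamma> < real CARD('n)"
    and "p > 0" and "q > 0" and "p * q > (\<gamma> - 1)^2"
    and "\<sigma>\<^sub>1 > - \<beta> * \<gamma>" and "\<sigma>\<^sub>2 > - \<beta> * \<gamma>"
    and "double_bounded c\<^sub>1" and "double_bounded c\<^sub>2"
    and "wolff_solution \<beta> \<gamma> p q \<sigma>\<^sub>1 \<sigma>\<^sub>2 c\<^sub>1 c\<^sub>2 u v"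
    and "\<forall>x. u x > 0" and "\<forall>x. v x > 0"
    and "\<exists>M. \<forall>x. u x \<le> M \<and> v x \<le> M"
  shows "(\<forall>\<theta>\<^sub>1 \<theta>\<^sub>2. \<theta>\<^sub>1 < q0 \<beta> \<gamma> p q \<sigma>\<^sub>1 \<sigma>\<^sub>2 \<and> \<theta>\<^sub>2 < p0 \<beta> \<gamma> p q \<sigma>\<^sub>1 \<sigma>\<^sub>2 \<longrightarrow>
            \<not> (\<exists>c>0. (AE x in lebesgue. u x \<ge> c * (1 + norm x) powr (- \<theta>\<^sub>1)) \<or>
                     (AE x in lebesgue. v x \<ge> c * (1 + norm x) powr (- \<theta>\<^sub>2))))
       \<and> (\<forall>\<theta>\<^sub>3 \<theta>\<^sub>4. \<theta>\<^sub>3 > q0 \<beta> \<gamma> p q \<sigma>\<^sub>1 \<sigma>\<^sub>2 \<and> \<theta>\<^sub>4 > p0 \<beta> \<gamma> p q \<sigma>\<^sub>1 \<sigma>\<^sub>2 \<and>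
              \<not> integrable_pair \<beta> \<gamma> p q \<sigma>\<^sub>1 \<sigma>\<^sub>2 u v \<longrightarrow>
            \<not> (\<exists>C>0. (AE x in lebesgue. u x \<le> C * (1 + norm x) powr (- \<theta>\<^sub>3)) \<or>
                     (AE x in lebesgue. v x \<le> C * (1 + norm x) powr (- \<theta>\<^sub>4))))
       \<and> (decaying u v \<and> \<not> integrable_pair \<beta> \<gamma> p q \<sigma>\<^sub>1 \<sigma>\<^sub>2 u v \<longrightarrow>
            sim_pow u (q0 \<beta> \<gamma> p q \<sigma>\<^sub>1 \<sigma>\<^sub>2) \<and> sim_pow v (p0 \<beta> \<gamma> p q \<sigma>\<^sub>1 \<sigma>\<^sub>2))"
proof -
  obtain M where M: "\<And>x. u x \<le> M" "\<And>x. v x \<le> M"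
    using assms(15) by blast
  interpret wolff_system \<beta> \<gamma> p q \<sigma>\<^sub>1 \<sigma>\<^sub>2 M c\<^sub>1 c\<^sub>2 u v
    using assms M by unfold_locales auto
  interpret swapped: wolff_system \<beta> \<gamma> q p \<sigma>\<^sub>2 \<sigma>\<^sub>1 M c\<^sub>2 c\<^sub>1 v u
    by (rule swap)
  have lower: "\<not> ge_powr v \<theta>" if "\<theta> < P" for \<theta>
    using swapped.not_ge_powr_u that by (simp add: p0_eq_q0_swap)
  have upper: "\<not> le_powr v \<theta>" if "\<theta> > P" "\<not> integrable_pair \<beta> \<gamma> p q \<sigma>\<^sub>1 \<sigma>\<^sub>2 u v" for \<theta>
    using swapped.integrable_pair_of_le_powr_u[of \<theta>] that by (auto simp: p0_eq_q0_swap integrable_pair_swap)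
  have "\<not> (\<exists>c>0. (AE x in lebesgue. u x \<ge> c * (1 + norm x) powr (- \<theta>\<^sub>1)) \<or>
      (AE x in lebesgue. v x \<ge> c * (1 + norm x) powr (- \<theta>\<^sub>2)))"
    if "\<theta>\<^sub>1 < Q" "\<theta>\<^sub>2 < P" for \<theta>\<^sub>1 \<theta>\<^sub>2
    using not_ge_powr_u[OF that(1)] lower[OF that(2)] unfolding ge_powr_def by blast
  moreover have "\<not> (\<exists>C>0. (AE x in lebesgue. u x \<le> C * (1 + norm x) powr (- \<theta>\<^sub>3)) \<or>
      (AE x in lebesgue. v x \<le> C * (1 + norm x) powr (- \<theta>\<^sub>4)))"
    if "\<theta>\<^sub>3 > Q" "\<theta>\<^sub>4 > P" "\<not> integrable_pair \<beta> \<gamma> p q \<sigma>\<^sub>1 \<sigma>\<^sub>2 u v" for \<theta>\<^sub>3 \<theta>\<^sub>4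
    using integrable_pair_of_le_powr_u[OF that(1)] upper[OF that(2,3)] that(3) unfolding le_powr_def by blast
  moreover have "sim_pow u Q \<and> sim_pow v P"
    if dec: "decaying u v" and not_int: "\<not> integrable_pair \<beta> \<gamma> p q \<sigma>\<^sub>1 \<sigma>\<^sub>2 u v"
  proof -
    obtain \<theta>\<^sub>1 \<theta>\<^sub>2 where \<theta>: "\<theta>\<^sub>1 > 0" "\<theta>\<^sub>2 > 0" "sim_pow u \<theta>\<^sub>1" "sim_pow v \<theta>\<^sub>2"
      using dec unfolding decaying_def by blast
    \<comment> \<open>Once the exponents are identified, the assumed two-sided decay is already the
      claim.\<close>
    have "\<theta>\<^sub>1 = Q"
      using sim_pow_exponent_u \<theta> not_int by blast
    moreover have "\<theta>\<^sub>2 = P"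
      using swapped.sim_pow_exponent_u[of \<theta>\<^sub>2] \<theta> not_int by (simp add: p0_eq_q0_swap integrable_pair_swap)
    ultimately show ?thesis
      using \<theta> by simp
  qed
  ultimately show ?thesis
    by blast
qed

end
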